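(* Suppose the standing assumptions (A1)–(A3) of the context hold, and let $\{x_k\}$ be an infinite sequence generated by the SQP algorithm of the context. If MFCQ is satisfied at all accumulation points of $\{x_k\}$, then every accumulation point $\bar x$ of $\{x_k\}$ is a KKT point of the problem: there exist a subsequence $\{x_{k_s}\}$ of $\{x_k\}$ with $x_{k_s}\to\bar x$ and $\bar\lambda\in\mathbb{R}^m$ such that $0\in\bar\partial f(\bar x)-\sum_{i\in\mathcal E\cup\mathcal I}\bar\lambda_i\nabla c_i(\bar x)$; $c_i(\bar x)=0$ for $i\in\mathcal E$; and $c_i(\bar x)\ge 0$, $\bar\lambda_i\ge 0$, $\bar\lambda_i c_i(\bar x)=0$ for $i\in\mathcal I$.
   Context: Problem: $\mathcal E,\mathcal I$ are finite disjoint index sets, $m_e=|\mathcal E|$, $m_i=|\mathcal I|$, $m=m_e+m_i$, $c_i:\mathbb{R}^n\to\mathbb{R}$ for $i\in\mathcal E\cup\mathcal I$, $f:\mathbb{R}^n\to\mathbb{R}\cup\{+\infty\}$. Minimize $f(x)$ subject to $c_i(x)=0$ ($i\in\mathcal E$), $c_i(x)\ge0$ ($i\in\mathcal I$); the feasible set is $\Omega$. Notation: $[y]^-=\max\{0,-y\}$, $v(x)=\sum_{i\in\mathcal E}|c_i(x)|+\sum_{i\in\mathcal I}[c_i(x)]^-$, merit function $\phi(x,\theta)=f(x)+\theta v(x)$; $\bar\partial f$ is the Clarke subdifferential; $\|\cdot\|$ is the Euclidean norm. $f$ is upper-$C^2$ on an open set $O$ if near each point of $O$ it can be written $f(x)=\min_{t\in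 T}f_t(x)$ with $T$ a compact space, each $f_t$ of class $C^2$, and $f_t$ and its partial derivatives in $x$ up to order 2 jointly continuous in $(t,x)$. SQP algorithm: given $x_0$, $\theta_0>0$, $\eta\in(0,1)$, $\tau_\alpha\in(0,1)$, $\gamma>0$ (stopping tolerances zero: it stops only if $d_k=0$ and $v(x_k)=0$). At iteration $k$: take any $g_k\in\bar\partial f(x_k)$ and a symmetric matrix $B_k$; let $(d_k,v^k,w^k,t^k)$ solve $$\min_{d,v,w,t} f(x_k)+g_k^Td+\tfrac12 d^TB_kd+\theta_k\sum_{i\in\mathcal E}(v_i+w_i)+\theta_k\sum_{i\in\mathcal I}t_i$$ s.t. $c_i(x_k)+\nabla c_i(x_k)^Td=v_i-w_i$ ($i\in\mathcal E$), $c_i(x_k)+\nabla c_i(x_k)^Td\ge -t_i$ ($i\in\mathcal I$), $v,w,t\ge0$. Let $\lambda^{k+1}\in\mathbb{R}^m$ be the Lagrange multiplier of the linearized constraints, i.e. with some $p^{k+1},q^{k+1},r^{k+1}\ge0$: $g_k+B_kd_k-\sum_{i}\lambda_i^{k+1}\nabla c_i(x_k)=0$; $\lambda_i^{k+1}\ge0$ and $\lambda_i^{k+1}[c_i(x_k)+\nabla c_i(x_k)^Td_k+t_i^k]=0$ for $i\in\mathcal I$; $\theta_k+\lambda_i^{k+1}=p_i^{k+1}$, $\theta_k-\lambda_i^{k+1}=q_i^{k+1}$, $p_i^{k+1}v_i^k=q_i^{k+1}w_i^k=0$ for $i\in\mathcal E$; $\theta_k-\lambda_i^{k+1}=r_i^{k+1}$,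 $r_i^{k+1}t_i^k=0$ for $i\in\mathcal I$. Set $\theta_{k+1}=\max\{\theta_k,\|\lambda^{k+1}\|_\infty+\gamma\}$. Let $\alpha_k$ be the first of $1,\tau_\alpha,\tau_\alpha^2,\dots$ such that $\phi(x_k,\theta_k)-\phi(x_k+\alpha_kd_k,\theta_k)\ge\eta\alpha_k\tfrac12d_k^TB_kd_k$; set $x_{k+1}=x_k+\alpha_kd_k$. Standing assumptions. (A1) $f$ is (finite,) Lipschitz continuous and upper-$C^2$ on an open set containing the compact convex set $D$ of (A3); $\rho>0$ is a constant such that $-f+\frac\rho2\|\cdot\|^2$ is convex on $D$ and $f(x)-f(\bar x)-\langle g,x-\bar x\rangle\le\frac\rho2\|x-\bar x\|^2$ for all $x,\bar x\in D$, $g\in\bar\partial f(\bar x)$. (A2) Each $c_i$ is continuously differentiable with Lipschitz gradient, and $H\ge0$ satisfies $|c_i(x')-c_i(x)-\nabla c_i(x)^T(x'-x)|\le\frac H2\|x-x'\|^2$ for all $x,x'$ and all $i$. (A3) There is a compact convex set $D\subset\mathbb{R}^n$ with $\Omega\subseteq D$ and $x_k,\,x_k+d_k\in D$ for all $k$; the $B_k$ are symmetric, uniformly bounded, and for some $b>0$, $d^TB_kd\ge b\|d\|^2$ for all $k$ and $d\in\mathbb{R}^n$. MFCQ: for a feasible point $x$ let $\mathcal A(x)=\mathcal E\cup\{i\in\mathcal I: c_i(x)=0\}$. MFCQ holds at $x$ if $\nabla c_i(x)$, $i\in\mathcal E$, are linearly independent and there is $w\in\mathbb{R}^n$ with $\nabla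 c_i(x)^Tw>0$ for all $i\in\mathcal A(x)\cap\mathcal I$ and $\nabla c_i(x)^Tw=0$ for all $i\in\mathcal E$ (so MFCQ is a condition on feasible points). *)

theory Defs
  imports "HOL-Analysis.Analysis"
begin

section \<open>Gradients, Clarke subdifferential, upper-C2 functions\<close>

(* Only meaningful where h is differentiable (see nabla_eq). *)
definition nabla :: "(real^'n \<Rightarrow> real) \<Rightarrow> real^'n \<Rightarrow> real^'n" where
  "nabla h x = (THE D. GDERIV h x :> D)"

lemma nabla_eq:
  assumes "GDERIV h x :> D"
  shows "nabla h x = D"
  unfolding nabla_def
proof (rule the_equality)
  fix D' assume "GDERIV h x :> D'"
  with assms have "(\<lambda>u. inner u D') = (\<lambda>u. inner u D)"
    unfolding gderiv_def using has_derivative_unique by blast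
  then have "inner u D' = inner u D" for u by meson
  then show "D' = D" by (metis inner_commute vector_eq_rdot)
qed (rule assms)

(* Clarke's generalized directional derivative: the upper limit of (f(y+su)-f(y))/s as
   y tends to x and s decreases to 0. The value y = x is admitted, hence nhds and not at.
   As in Clarke's definition for locally Lipschitz functions, this and the next definition
   are intended for points near which f is finite and Lipschitz. *)
definition clarke_dir :: "(real^'n \<Rightarrow> ereal) \<Rightarrow> real^'n \<Rightarrow> real^'n \<Rightarrow> ereal" where
  "clarke_dir f x u =
     Limsup (nhds x \<times>\<^sub>F at_right (0::real)) (\<lambda>(y, s). (f (y + s *\<^sub>R u) - f y) / ereal s)"

definition clarke_subdiff :: "(real^'n \<Rightarrow> ereal) \<Rightarrow> real^'n \<Rightarrow> (real^'n) set" where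
  "clarke_subdiff f x = {g. \<forall>u. ereal (g \<bullet> u) \<le> clarke_dir f x u}"

(* The compact space is an abstract topology T on a subset (topspace T) of the type 't; it may
   depend on the point z. As HOL cannot quantify over types inside a formula, 't is a
   parameter; a hypothesis upper_C2_on TYPE('t) in a theorem with 't free stands for the
   existence of such index spaces of any type.
   G and K are the gradient and the Hessian in x of the family F. Their joint continuity
   (equivalently, that of all entries) contains the requirement that each F t is C2. *)
definition upper_C2_on ::
    "'t itself \<Rightarrow> (real^'n) set \<Rightarrow> (real^'n \<Rightarrow> ereal) \<Rightarrow> bool" where
  "upper_C2_on _ S f \<longleftrightarrow>
     (\<forall>z\<in>S. \<exists>U (T :: 't topology) (F :: 't \<Rightarrow> real^'n \<Rightarrow> real)
            (G :: 't \<Rightarrow> real^'n \<Rightarrow> real^'n) (K :: 't \<Rightarrow> real^'n \<Rightarrow> real^'n^'n).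
        open U \<and> z \<in> U \<and> compact_space T \<and>
        (\<forall>x\<in>U. (\<exists>t\<in>topspace T. f x = ereal (F t x)) \<and> (\<forall>t\<in>topspace T. f x \<le> ereal (F t x))) \<and>
        (\<forall>t\<in>topspace T. \<forall>x\<in>U.
            (GDERIV (F t) x :> G t x) \<and> (G t has_derivative (\<lambda>u. K t x *v u)) (at x)) \<and>
        continuous_map (prod_topology T (top_of_set U)) euclidean (\<lambda>(t, x). F t x) \<and>
        continuous_map (prod_topology T (top_of_set U)) euclidean (\<lambda>(t, x). G t x) \<and>
        continuous_map (prod_topology T (top_of_set U)) euclidean (\<lambda>(t, x). K t x))"


section \<open>The constrained problem\<close>

definition feasible_set :: "'i set \<Rightarrow> 'i set \<Rightarrow> ('i \<Rightarrow> real^'n \<Rightarrow> real) \<Rightarrow> (real^'n) set" where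
  "feasible_set E I c = {x. (\<forall>i\<in>E. c i x = 0) \<and> (\<forall>i\<in>I. c i x \<ge> 0)}"

definition neg_part :: "real \<Rightarrow> real" where
  "neg_part y = max 0 (- y)"

definition viol :: "'i set \<Rightarrow> 'i set \<Rightarrow> ('i \<Rightarrow> real^'n \<Rightarrow> real) \<Rightarrow> real^'n \<Rightarrow> real" where
  "viol E I c x = (\<Sum>i\<in>E. \<bar>c i x\<bar>) + (\<Sum>i\<in>I. neg_part (c i x))"

definition merit :: "(real^'n \<Rightarrow> ereal) \<Rightarrow> 'i set \<Rightarrow> 'i set \<Rightarrow> ('i \<Rightarrow> real^'n \<Rightarrow> real) \<Rightarrow>
    real^'n \<Rightarrow> real \<Rightarrow> ereal" where
  "merit f E I c x \<theta> = f x + ereal (\<theta> * viol E I c x)"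

definition active_set :: "'i set \<Rightarrow> 'i set \<Rightarrow> ('i \<Rightarrow> real^'n \<Rightarrow> real) \<Rightarrow> real^'n \<Rightarrow> 'i set" where
  "active_set E I c x = E \<union> {i\<in>I. c i x = 0}"

(* MFCQ is a condition on feasible points, so feasibility is part of it. The first two gradient
   conditions say that the indexed family of the gradients is linearly independent. *)
definition mfcq :: "'i set \<Rightarrow> 'i set \<Rightarrow> ('i \<Rightarrow> real^'n \<Rightarrow> real) \<Rightarrow> real^'n \<Rightarrow> bool" where
  "mfcq E I c x \<longleftrightarrow>
     x \<in> feasible_set E I c \<and>
     inj_on (\<lambda>i. nabla (c i) x) E \<and>
     independent ((\<lambda>i. nabla (c i) x) ` E) \<and>
     (\<exists>w. (\<forall>i \<in> active_set E I c x \<inter> I. nabla (c i) x \<bullet> w > 0) \<and>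
          (\<forall>i\<in>E. nabla (c i) x \<bullet> w = 0))"

definition accumulation_point :: "(nat \<Rightarrow> 'a::topological_space) \<Rightarrow> 'a \<Rightarrow> bool" where
  "accumulation_point x z \<longleftrightarrow> (\<forall>U. open U \<and> z \<in> U \<longrightarrow> infinite {k. x k \<in> U})"


section \<open>The SQP algorithm\<close>

(* Vectors indexed by E, by I or by E \<union> I are functions on 'i of which only the values on the
   respective set matter. *)

(* The inserted 0 only matters for the problem without constraints. *)
definition inf_norm_on :: "'i set \<Rightarrow> ('i \<Rightarrow> real) \<Rightarrow> real" where
  "inf_norm_on J l = Max (insert 0 ((\<lambda>i. \<bar>l i\<bar>) ` J))"

definition qp_feasible :: "'i set \<Rightarrow> 'i set \<Rightarrow> ('i \<Rightarrow> real^'n \<Rightarrow> real) \<Rightarrow> real^'n \<Rightarrow>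
    real^'n \<Rightarrow> ('i \<Rightarrow> real) \<Rightarrow> ('i \<Rightarrow> real) \<Rightarrow> ('i \<Rightarrow> real) \<Rightarrow> bool" where
  "qp_feasible E I c x d v w t \<longleftrightarrow>
     (\<forall>i\<in>E. c i x + nabla (c i) x \<bullet> d = v i - w i \<and> v i \<ge> 0 \<and> w i \<ge> 0) \<and>
     (\<forall>i\<in>I. c i x + nabla (c i) x \<bullet> d \<ge> - t i \<and> t i \<ge> 0)"

definition qp_objective :: "(real^'n \<Rightarrow> ereal) \<Rightarrow> 'i set \<Rightarrow> 'i set \<Rightarrow> real^'n \<Rightarrow> real^'n \<Rightarrow>
    real^'n^'n \<Rightarrow> real \<Rightarrow> real^'n \<Rightarrow> ('i \<Rightarrow> real) \<Rightarrow> ('i \<Rightarrow> real) \<Rightarrow> ('i \<Rightarrow> real) \<Rightarrow> ereal" where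
  "qp_objective f E I x g B \<theta> d v w t =
     f x + ereal (g \<bullet> d + 1/2 * (d \<bullet> (B *v d)) + \<theta> * (\<Sum>i\<in>E. v i + w i) + \<theta> * (\<Sum>i\<in>I. t i))"

definition qp_solution :: "(real^'n \<Rightarrow> ereal) \<Rightarrow> 'i set \<Rightarrow> 'i set \<Rightarrow> ('i \<Rightarrow> real^'n \<Rightarrow> real) \<Rightarrow>
    real^'n \<Rightarrow> real^'n \<Rightarrow> real^'n^'n \<Rightarrow> real \<Rightarrow>
    real^'n \<Rightarrow> ('i \<Rightarrow> real) \<Rightarrow> ('i \<Rightarrow> real) \<Rightarrow> ('i \<Rightarrow> real) \<Rightarrow> bool" where
  "qp_solution f E I c x g B \<theta> d v w t \<longleftrightarrow>
     qp_feasible E I c x d v w t \<and>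
     (\<forall>d' v' w' t'. qp_feasible E I c x d' v' w' t' \<longrightarrow>
        qp_objective f E I x g B \<theta> d v w t \<le> qp_objective f E I x g B \<theta> d' v' w' t')"

definition qp_multiplier :: "'i set \<Rightarrow> 'i set \<Rightarrow> ('i \<Rightarrow> real^'n \<Rightarrow> real) \<Rightarrow>
    real^'n \<Rightarrow> real^'n \<Rightarrow> real^'n^'n \<Rightarrow> real \<Rightarrow>
    real^'n \<Rightarrow> ('i \<Rightarrow> real) \<Rightarrow> ('i \<Rightarrow> real) \<Rightarrow> ('i \<Rightarrow> real) \<Rightarrow> ('i \<Rightarrow> real) \<Rightarrow> bool" where
  "qp_multiplier E I c x g B \<theta> d v w t l \<longleftrightarrow>
     (\<exists>p q r.
        g + B *v d - (\<Sum>i\<in>E \<union> I. l i *\<^sub>R nabla (c i) x) = 0 \<and>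
        (\<forall>i\<in>I. l i \<ge> 0 \<and> l i * (c i x + nabla (c i) x \<bullet> d + t i) = 0) \<and>
        (\<forall>i\<in>E. p i \<ge> 0 \<and> q i \<ge> 0 \<and> \<theta> + l i = p i \<and> \<theta> - l i = q i \<and>
               p i * v i = 0 \<and> q i * w i = 0) \<and>
        (\<forall>i\<in>I. r i \<ge> 0 \<and> \<theta> - l i = r i \<and> r i * t i = 0))"

definition sufficient_decrease :: "(real^'n \<Rightarrow> ereal) \<Rightarrow> 'i set \<Rightarrow> 'i set \<Rightarrow>
    ('i \<Rightarrow> real^'n \<Rightarrow> real) \<Rightarrow> real \<Rightarrow> real^'n \<Rightarrow> real^'n^'n \<Rightarrow> real \<Rightarrow> real^'n \<Rightarrow> real \<Rightarrow> bool" where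
  "sufficient_decrease f E I c \<eta> x B \<theta> d a \<longleftrightarrow>
     merit f E I c x \<theta> - merit f E I c (x + a *\<^sub>R d) \<theta> \<ge> ereal (\<eta> * a * (1/2) * (d \<bullet> (B *v d)))"

(* An infinite run, i.e. one whose stopping test never succeeds. The multiplier computed in
   iteration k is l (Suc k); l 0 is unused. *)
definition sqp_run :: "(real^'n \<Rightarrow> ereal) \<Rightarrow> 'i set \<Rightarrow> 'i set \<Rightarrow> ('i \<Rightarrow> real^'n \<Rightarrow> real) \<Rightarrow>
    real \<Rightarrow> real \<Rightarrow> real \<Rightarrow>
    (nat \<Rightarrow> real^'n) \<Rightarrow> (nat \<Rightarrow> real^'n) \<Rightarrow> (nat \<Rightarrow> real^'n^'n) \<Rightarrow> (nat \<Rightarrow> real) \<Rightarrow>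
    (nat \<Rightarrow> real^'n) \<Rightarrow> (nat \<Rightarrow> 'i \<Rightarrow> real) \<Rightarrow> (nat \<Rightarrow> 'i \<Rightarrow> real) \<Rightarrow> (nat \<Rightarrow> 'i \<Rightarrow> real) \<Rightarrow>
    (nat \<Rightarrow> 'i \<Rightarrow> real) \<Rightarrow> (nat \<Rightarrow> real) \<Rightarrow> bool" where
  "sqp_run f E I c \<eta> \<tau> \<gamma> x g B \<theta> d v w t l \<alpha> \<longleftrightarrow>
     \<theta> 0 > 0 \<and> 0 < \<eta> \<and> \<eta> < 1 \<and> 0 < \<tau> \<and> \<tau> < 1 \<and> \<gamma> > 0 \<and>
     (\<forall>k.
        g k \<in> clarke_subdiff f (x k) \<and>
        transpose (B k) = B k \<and>
        qp_solution f E I c (x k) (g k) (B k) (\<theta> k) (d k) (v k) (w k) (t k) \<and>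
        \<not> (d k = 0 \<and> viol E I c (x k) = 0) \<and>
        qp_multiplier E I c (x k) (g k) (B k) (\<theta> k) (d k) (v k) (w k) (t k) (l (Suc k)) \<and>
        \<theta> (Suc k) = max (\<theta> k) (inf_norm_on (E \<union> I) (l (Suc k)) + \<gamma>) \<and>
        (\<exists>j. \<alpha> k = \<tau> ^ j \<and>
             sufficient_decrease f E I c \<eta> (x k) (B k) (\<theta> k) (d k) (\<tau> ^ j) \<and>
             (\<forall>j'<j. \<not> sufficient_decrease f E I c \<eta> (x k) (B k) (\<theta> k) (d k) (\<tau> ^ j'))) \<and>
        x (Suc k) = x k + \<alpha> k *\<^sub>R d k)"


section \<open>Standing assumptions\<close>

definition objective_assms :: "'t itself \<Rightarrow> (real^'n \<Rightarrow> ereal) \<Rightarrow> (real^'n) set \<Rightarrow> real \<Rightarrow> bool" where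
  "objective_assms ty f D \<rho> \<longleftrightarrow>
     (\<exists>S. open S \<and> D \<subseteq> S \<and> (\<forall>x\<in>S. \<bar>f x\<bar> \<noteq> \<infinity>) \<and>
          (\<exists>L. L-lipschitz_on S (\<lambda>x. real_of_ereal (f x))) \<and> upper_C2_on ty S f) \<and>
     \<rho> > 0 \<and>
     convex_on D (\<lambda>x. - real_of_ereal (f x) + \<rho> / 2 * (norm x)\<^sup>2) \<and>
     (\<forall>x\<in>D. \<forall>z\<in>D. \<forall>g\<in>clarke_subdiff f z.
        f x - f z - ereal (g \<bullet> (x - z)) \<le> ereal (\<rho> / 2 * (norm (x - z))\<^sup>2))"

definition constraint_assms :: "'i set \<Rightarrow> 'i set \<Rightarrow> ('i \<Rightarrow> real^'n \<Rightarrow> real) \<Rightarrow> real \<Rightarrow> bool" where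
  "constraint_assms E I c H \<longleftrightarrow>
     (\<forall>i\<in>E \<union> I. (\<forall>x. c i differentiable (at x)) \<and> continuous_on UNIV (nabla (c i)) \<and>
                (\<exists>L. L-lipschitz_on UNIV (nabla (c i)))) \<and>
     H \<ge> 0 \<and>
     (\<forall>i\<in>E \<union> I. \<forall>x x'. \<bar>c i x' - c i x - nabla (c i) x \<bullet> (x' - x)\<bar> \<le> H / 2 * (norm (x - x'))\<^sup>2)"

definition iterate_assms :: "'i set \<Rightarrow> 'i set \<Rightarrow> ('i \<Rightarrow> real^'n \<Rightarrow> real) \<Rightarrow> (real^'n) set \<Rightarrow>
    (nat \<Rightarrow> real^'n) \<Rightarrow> (nat \<Rightarrow> real^'n) \<Rightarrow> (nat \<Rightarrow> real^'n^'n) \<Rightarrow> real \<Rightarrow> bool" where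
  "iterate_assms E I c D x d B b \<longleftrightarrow>
     compact D \<and> convex D \<and> feasible_set E I c \<subseteq> D \<and>
     (\<forall>k. x k \<in> D \<and> x k + d k \<in> D) \<and>
     (\<forall>k. transpose (B k) = B k) \<and> bounded (range B) \<and>
     b > 0 \<and> (\<forall>k y. y \<bullet> (B k *v y) \<ge> b * (norm y)\<^sup>2)"

end

theory Submission
  imports Defs
begin

text \<open>MFCQ keeps the multipliers of the quadratic programs bounded: were they unbounded along
  iterates converging to \<open>z\<close>, the limit of the normalized multipliers would be a nonzero vector
  contradicting MFCQ at \<open>z\<close>. Hence the penalty parameters are bounded, so the line search accepts
  step sizes bounded away from zero, and the decrease of the merit function, corrected for the
  bounded total growth of the penalty parameter, forces \<open>d k\<close> to tend to zero. The optimality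
  conditions of the quadratic programs then pass to the limit because the Clarke subdifferential
  is locally bounded with closed graph.\<close>

section \<open>Sequences\<close>

text \<open>Forward, every ball of radius 1/(n+1) contains infinitely many terms, so indices can be
  chosen increasing. Backward, \<open>r\<close> is injective, so infinitely many indices, not merely
  values, land in \<open>U\<close>.\<close>

lemma accumulation_point_iff_subseq:
  fixes x :: "nat \<Rightarrow> 'a::metric_space"
  shows "accumulation_point x z \<longleftrightarrow> (\<exists>r. strict_mono r \<and> (\<lambda>k. x (r k)) \<longlonglongrightarrow> z)"
proof
  assume acc: "accumulation_point x z"
  have inf: "infinite {k. x k \<in> ball z (inverse (Suc n))}" for n
    using acc unfolding accumulation_point_def by (metis open_ball centre_in_ball inverse_positive_iff_positive of_nat_0_less_iff zero_less_Suc)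
  have "\<exists>r. \<forall>n. x (r n) \<in> ball z (inverse (Suc n)) \<and> r n < r (Suc n)"
  proof (rule dependent_nat_choice)
    show "\<exists>k. x k \<in> ball z (inverse (Suc 0))"
      using not_finite_existsD[OF inf] .
    show "\<exists>k'. x k' \<in> ball z (inverse (Suc (Suc n))) \<and> k < k'" for k n
      using inf[of "Suc n"] unfolding infinite_nat_iff_unbounded by blast
  qed
  then obtain r where r: "\<And>n. x (r n) \<in> ball z (inverse (Suc n))" "\<And>n. r n < r (Suc n)"
    by blast
  have "(\<lambda>n. dist z (x (r n))) \<longlonglongrightarrow> 0"
    by (rule Lim_null_comparison[OF _ LIMSEQ_inverse_real_of_nat])
      (use r(1) in \<open>auto intro!: always_eventually less_imp_le\<close>)
  then have "(\<lambda>n. x (r n)) \<longlonglongrightarrow> z"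
    by (subst tendsto_dist_iff) (simp add: dist_commute)
  then show "\<exists>r. strict_mono r \<and> (\<lambda>k. x (r k)) \<longlonglongrightarrow> z"
    using r(2) by (auto simp: strict_mono_Suc_iff)
next
  assume "\<exists>r. strict_mono r \<and> (\<lambda>k. x (r k)) \<longlonglongrightarrow> z"
  then obtain r where r: "strict_mono r" "(\<lambda>k. x (r k)) \<longlonglongrightarrow> z" by blast
  show "accumulation_point x z"
    unfolding accumulation_point_def
  proof (intro allI impI)
    fix U assume "open U \<and> z \<in> U"
    then obtain N where N: "\<And>k. k \<ge> N \<Longrightarrow> x (r k) \<in> U"
      using topological_tendstoD[OF r(2)] unfolding eventually_sequentially by blast
    have "inj_on r {N..}"
      using strict_mono_imp_inj_on[OF r(1)] inj_on_subset by blast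
    then have "infinite (r ` {N..})"
      by (simp add: finite_image_iff infinite_Ici)
    then show "infinite {k. x k \<in> U}"
      by (rule infinite_super[rotated]) (use N in auto)
  qed
qed

text \<open>One index is added at a time: each further subsequence keeps the limits already
  obtained.\<close>

lemma convergent_subseq_finite_family:
  fixes a :: "nat \<Rightarrow> 'i \<Rightarrow> 'a::heine_borel"
  assumes "finite J" and "\<And>i. i \<in> J \<Longrightarrow> bounded (range (\<lambda>k. a k i))"
  shows "\<exists>(r :: nat \<Rightarrow> nat) L. strict_mono r \<and> (\<forall>i\<in>J. (\<lambda>k. a (r k) i) \<longlonglongrightarrow> L i)"
  using assms
proof (induction rule: finite_induct)
  case empty
  show ?case by (auto intro: strict_mono_id)
next
  case (insert j J)
  then obtain r L where r: "strict_mono (r :: nat \<Rightarrow> nat)" "\<forall>i\<in>J. (\<lambda>k. a (r k) i) \<longlonglongrightarrow> L i"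
    by force
  have "bounded (range (\<lambda>k. a (r k) j))"
    by (rule bounded_subset[OF insert.prems[of j]]) auto
  from bounded_imp_convergent_subsequence[OF this]
  obtain M s where s: "strict_mono s" "((\<lambda>k. a (r k) j) \<circ> s) \<longlonglongrightarrow> M" by blast
  have "(\<lambda>k. a ((r \<circ> s) k) i) \<longlonglongrightarrow> (L(j := M)) i" if "i \<in> insert j J" for i
  proof (cases "i = j")
    case True
    then show ?thesis using s(2) by (simp add: o_def)
  next
    case False
    then have "(\<lambda>k. a (r k) i) \<longlonglongrightarrow> L i" using that r(2) by blast
    from LIMSEQ_subseq_LIMSEQ[OF this s(1)] show ?thesis using False by (simp add: o_def)
  qed
  then show ?case using strict_mono_o[OF r(1) s(1)] by blast
qed

text \<open>A decreasing sequence bounded below has differences tending to zero, and these dominate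
  \<open>\<kappa> * a k\<close>. Later \<open>a\<close> is the squared step length and
  \<open>P\<close> a corrected merit value.\<close>

lemma sufficient_decrease_imp_null:
  fixes P a :: "nat \<Rightarrow> real"
  assumes "\<kappa> > 0" and dec: "\<And>k. P (Suc k) \<le> P k - \<kappa> * a k"
    and "\<And>k. a k \<ge> 0" and "\<And>k. P k \<ge> m"
  shows "a \<longlonglongrightarrow> 0"
proof -
  have "P (Suc k) \<le> P k" for k
    using dec[of k] assms(3)[of k] \<open>\<kappa> > 0\<close> by (smt (verit) mult_nonneg_nonneg)
  then have "decseq P" by (simp add: decseq_Suc_iff)
  then obtain L where L: "P \<longlonglongrightarrow> L" using decseq_convergent assms(4) by blast
  have "(\<lambda>k. (P k - P (Suc k)) / \<kappa>) \<longlonglongrightarrow> (L - L) / \<kappa>"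
    using \<open>\<kappa> > 0\<close> by (intro tendsto_intros L LIMSEQ_Suc) simp
  then have lim: "(\<lambda>k. (P k - P (Suc k)) / \<kappa>) \<longlonglongrightarrow> 0" by simp
  have "norm (a k) \<le> (P k - P (Suc k)) / \<kappa>" for k
    using dec[of k] assms(3)[of k] \<open>\<kappa> > 0\<close> by (simp add: field_simps)
  then show ?thesis by (intro Lim_null_comparison[OF _ lim] always_eventually allI)
qed

lemma bounded_matrices_imp_uniform_bound:
  fixes B :: "'k \<Rightarrow> real^'n^'m"
  assumes "bounded (range B)"
  shows "\<exists>K\<ge>0. \<forall>k y. norm (B k *v y) \<le> K * norm y"
proof -
  obtain M where M: "\<And>k. norm (B k) \<le> M"
    using assms unfolding bounded_iff by auto
  have comp: "\<bar>B k $ i $ j\<bar> \<le> M" for k i j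
    using component_le_norm_cart[of "B k $ i" j] Finite_Cartesian_Product.norm_nth_le[of "B k" i]
      M[of k] by linarith
  define K where "K = real CARD('m) * real CARD('n) * M"
  have "M \<ge> 0" using M norm_ge_zero order_trans by blast
  have "norm (B k *v y) \<le> K * norm y" for k y
  proof -
    have "onorm ((*v) (B k)) \<le> K"
      unfolding K_def by (rule onorm_le_matrix_component[OF comp])
    then show ?thesis
      using onorm[OF matrix_vector_mul_bounded_linear, of "B k" y]
      by (meson mult_right_mono norm_ge_zero order_trans)
  qed
  moreover have "K \<ge> 0" using \<open>M \<ge> 0\<close> by (simp add: K_def)
  ultimately show ?thesis by blast
qed

section \<open>The Clarke subdifferential\<close>

text \<open>This is upper semicontinuity of \<open>clarke_dir\<close> in the base point: a bound
  \<open>C\<close> strictly above its value at \<open>z\<close> holds for all difference quotients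
  on a product neighbourhood, which also serves base points close to \<open>z\<close>.\<close>

lemma clarke_subdiff_closed_graph:
  assumes g: "\<And>k. g k \<in> clarke_subdiff f (y k)"
    and y: "y \<longlonglongrightarrow> z" and lim: "g \<longlonglongrightarrow> h"
  shows "h \<in> clarke_subdiff f z"
  unfolding clarke_subdiff_def
proof (intro CollectI allI)
  fix u
  show "ereal (h \<bullet> u) \<le> clarke_dir f z u"
  proof (rule dense_ge)
    fix C assume "clarke_dir f z u < C"
    then have "\<forall>\<^sub>F (p, s) in nhds z \<times>\<^sub>F at_right 0. (f (p + s *\<^sub>R u) - f p) / ereal s < C"
      unfolding clarke_dir_def by (drule_tac Limsup_lessD) (simp add: case_prod_unfold)
    then obtain P Q where P: "eventually P (nhds z)" and Q: "eventually Q (at_right (0::real))"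
      and PQ: "\<And>p s. P p \<Longrightarrow> Q s \<Longrightarrow> (f (p + s *\<^sub>R u) - f p) / ereal s < C"
      unfolding eventually_prod_filter by auto
    \<comment> \<open>A neighbourhood of \<open>z\<close> is a neighbourhood of each point near
      \<open>z\<close>; this carries the bound on the quotients over to the base points
      \<open>y k\<close>.\<close>
    have "\<forall>\<^sub>F p in nhds z. eventually P (nhds p)"
      using P by (simp add: eventually_eventually)
    then have "\<forall>\<^sub>F k in sequentially. eventually P (nhds (y k))"
      using y unfolding filterlim_iff by blast
    then have "\<forall>\<^sub>F k in sequentially. ereal (g k \<bullet> u) \<le> C"
    proof eventually_elim
      case (elim k)
      have "ereal (g k \<bullet> u) \<le> clarke_dir f (y k) u"
        using g[of k] by (simp add: clarke_subdiff_def)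
      also have "\<dots> \<le> C"
        unfolding clarke_dir_def
      proof (rule Limsup_bounded)
        have "\<forall>\<^sub>F q in nhds (y k) \<times>\<^sub>F at_right 0. P (fst q) \<and> Q (snd q)"
          using elim Q unfolding eventually_prod_filter by fastforce
        then show "\<forall>\<^sub>F q in nhds (y k) \<times>\<^sub>F at_right 0.
            (case q of (p, s) \<Rightarrow> (f (p + s *\<^sub>R u) - f p) / ereal s) \<le> C"
          by eventually_elim (use PQ in \<open>auto intro: less_imp_le\<close>)
      qed
      finally show ?case .
    qed
    moreover have "(\<lambda>k. ereal (g k \<bullet> u)) \<longlonglongrightarrow> ereal (h \<bullet> u)"
      by (intro tendsto_intros lim)
    ultimately show "ereal (h \<bullet> u) \<le> C"
      by (intro tendsto_upperbound[where F=sequentially]) auto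
  qed
qed

text \<open>Testing with the direction \<open>g\<close> itself bounds the squared norm of
  \<open>g\<close> by \<open>clarke_dir f x g\<close>, hence by \<open>L * norm g\<close>.\<close>

lemma clarke_subdiff_norm_le_lipschitz:
  assumes "open S" and "x \<in> S" and fin: "\<And>y. y \<in> S \<Longrightarrow> \<bar>f y\<bar> \<noteq> \<infinity>"
    and lip: "L-lipschitz_on S (\<lambda>y. real_of_ereal (f y))"
    and g: "g \<in> clarke_subdiff f x"
  shows "norm g \<le> L"
proof -
  \<comment> \<open>The quotient evaluates \<open>f\<close> at \<open>y\<close> and at the shifted
    point; both must lie in \<open>S\<close>, where \<open>f\<close> is finite and
    Lipschitz.\<close>
  have lim: "((\<lambda>(y, s). y + s *\<^sub>R g) \<longlongrightarrow> x + 0 *\<^sub>R g) (nhds x \<times>\<^sub>F at_right (0::real))"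
    unfolding case_prod_unfold
    by (intro tendsto_intros filterlim_compose[OF _ filterlim_fst]
        tendsto_mono[OF _ tendsto_ident_at] filterlim_ident
        filterlim_mono[OF filterlim_snd at_within_le_nhds order_refl])
  have "\<forall>\<^sub>F p in nhds x \<times>\<^sub>F at_right (0::real). fst p + snd p *\<^sub>R g \<in> S"
    using topological_tendstoD[OF lim, of S] assms(1,2) by (simp add: case_prod_unfold)
  moreover have "\<forall>\<^sub>F p in nhds x \<times>\<^sub>F at_right (0::real). fst p \<in> S \<and> snd p > 0"
    unfolding eventually_prod_filter
    using eventually_nhds_in_open[OF assms(1,2)] eventually_at_right_less[of "0::real"]
    by fastforce
  ultimately have "\<forall>\<^sub>F p in nhds x \<times>\<^sub>F at_right (0::real).
      (case p of (y, s) \<Rightarrow> (f (y + s *\<^sub>R g) - f y) / ereal s) \<le> ereal (L * norm g)"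
  proof eventually_elim
    case (elim p)
    obtain y s where p: "p = (y, s)" by force
    have S: "y \<in> S" "y + s *\<^sub>R g \<in> S" "s > 0" using elim p by auto
    define a b where "a = real_of_ereal (f (y + s *\<^sub>R g))" and "b = real_of_ereal (f y)"
    have ab: "f (y + s *\<^sub>R g) = ereal a" "f y = ereal b"
      using fin[OF S(1)] fin[OF S(2)] by (auto simp: a_def b_def ereal_real)
    have "a - b \<le> L * (s * norm g)"
      using lipschitz_onD[OF lip S(2,1)] S(3) by (simp add: a_def b_def dist_norm)
    then show ?case
      using S(3) by (simp add: p ab field_simps)
  qed
  then have "clarke_dir f x g \<le> ereal (L * norm g)"
    unfolding clarke_dir_def by (rule Limsup_bounded)
  moreover have "ereal (g \<bullet> g) \<le> clarke_dir f x g"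
    using g by (simp add: clarke_subdiff_def)
  ultimately have "norm g * norm g \<le> L * norm g"
    by (metis ereal_less_eq(3) order_trans dot_square_norm power2_eq_square)
  \<comment> \<open>For \<open>g = 0\<close> nothing can be cancelled, and the claim is the
    nonnegativity of the Lipschitz constant.\<close>
  then show ?thesis
    using lipschitz_on_nonneg[OF lip] by (cases "norm g = 0") auto
qed

section \<open>Multipliers under MFCQ\<close>

text \<open>Independence speaks of a set of vectors; injectivity of \<open>n\<close> turns it into a
  statement on the coefficients, read on the image through \<open>inv_into E n\<close>.\<close>

lemma independent_family_sum_zeroD:
  fixes n :: "'i \<Rightarrow> 'a::real_vector"
  assumes "finite E" "inj_on n E" "independent (n ` E)"
    and "(\<Sum>i\<in>E. \<mu> i *\<^sub>R n i) = 0" and "i \<in> E"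
  shows "\<mu> i = 0"
proof -
  have "(\<Sum>u\<in>n ` E. \<mu> (inv_into E n u) *\<^sub>R u) = (\<Sum>i\<in>E. \<mu> i *\<^sub>R n i)"
    using assms(2) by (simp add: sum.reindex)
  then have "\<mu> (inv_into E n (n i)) = 0"
    using assms by (intro independentD[OF assms(3), of "n ` E"]) auto
  then show ?thesis using assms by simp
qed

text \<open>Take \<open>e\<close> as a small positive multiple of the MFCQ direction
  \<open>w\<close>: active inequalities increase at first order, inactive ones stay positive by
  continuity, and for equalities both summands vanish.\<close>

lemma mfcq_strict_feasible_direction:
  assumes "mfcq E I c z" and "finite I"
  obtains e where "\<And>i. i \<in> I \<Longrightarrow> c i z + nabla (c i) z \<bullet> e > 0"
    and "\<And>i. i \<in> E \<Longrightarrow> c i z + nabla (c i) z \<bullet> e = 0"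
proof -
  obtain w where w: "\<And>i. i \<in> active_set E I c z \<inter> I \<Longrightarrow> nabla (c i) z \<bullet> w > 0"
      "\<And>i. i \<in> E \<Longrightarrow> nabla (c i) z \<bullet> w = 0"
    and feas: "z \<in> feasible_set E I c"
    using assms(1) unfolding mfcq_def by blast
  have "\<forall>\<^sub>F \<epsilon> in at_right 0. \<forall>i\<in>I. c i z + \<epsilon> * (nabla (c i) z \<bullet> w) > 0"
  proof (rule eventually_ball_finite[OF assms(2)], rule ballI)
    fix i assume i: "i \<in> I"
    show "\<forall>\<^sub>F \<epsilon> in at_right 0. c i z + \<epsilon> * (nabla (c i) z \<bullet> w) > 0"
    proof (cases "c i z = 0")
      case True
      then have "nabla (c i) z \<bullet> w > 0"
        using i by (intro w(1)) (auto simp: active_set_def)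
      then show ?thesis
        using eventually_at_right_less[of "0::real"] True by (auto elim!: eventually_mono)
    next
      case False
      then have "c i z > 0" using feas i by (force simp: feasible_set_def)
      moreover have "((\<lambda>\<epsilon>. c i z + \<epsilon> * (nabla (c i) z \<bullet> w)) \<longlongrightarrow> c i z + 0 * (nabla (c i) z \<bullet> w))
          (at_right 0)"
        by (intro tendsto_intros)
      ultimately show ?thesis by (intro order_tendstoD(1)) auto
    qed
  qed
  then obtain \<epsilon> :: real where "\<forall>i\<in>I. c i z + \<epsilon> * (nabla (c i) z \<bullet> w) > 0"
    using eventually_happens'[OF trivial_limit_at_right_real] by blast
  then show ?thesis
    using that[of "\<epsilon> *\<^sub>R w"] w(2) feas by (simp add: feasible_set_def)
qed

text \<open>Testing stationarity with \<open>d k - e\<close>, where \<open>e\<close> is strictly feasible for the constraints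
  linearized at \<open>z\<close>, kills the inequality part of a limit of the normalized multipliers; no
  smallness of \<open>d k\<close> is involved.\<close>
lemma mfcq_multipliers_not_at_top:
  fixes c :: "'i \<Rightarrow> real^'n \<Rightarrow> real" and l :: "nat \<Rightarrow> 'i \<Rightarrow> real"
  assumes fin: "finite E" "finite I" and mfcq: "mfcq E I c z"
    and y: "y \<longlonglongrightarrow> z"
    and cc: "\<And>i. i \<in> E \<union> I \<Longrightarrow> isCont (c i) z"
    and cn: "\<And>i. i \<in> E \<union> I \<Longrightarrow> isCont (nabla (c i)) z"
    and stat: "\<And>k. h k = (\<Sum>i\<in>E \<union> I. l k i *\<^sub>R nabla (c i) (y k))"
    and h: "\<And>k. norm (h k) \<le> Mh" and d: "\<And>k. norm (d k) \<le> Md"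
    and pos: "\<And>k i. i \<in> I \<Longrightarrow> l k i \<ge> 0"
    and comp: "\<And>k i. i \<in> E \<union> I \<Longrightarrow> l k i * (c i (y k) + nabla (c i) (y k) \<bullet> d k) \<le> 0"
  shows "\<not> filterlim (\<lambda>k. \<Sum>i\<in>E \<union> I. \<bar>l k i\<bar>) at_top sequentially"
proof
  let ?J = "E \<union> I"
  define S where "S k = (\<Sum>i\<in>?J. \<bar>l k i\<bar>)" for k
  assume "filterlim (\<lambda>k. \<Sum>i\<in>?J. \<bar>l k i\<bar>) at_top sequentially"
  then have S: "filterlim S at_top sequentially" by (simp add: S_def[abs_def])
  have finJ: "finite ?J" using fin by simp
  have S0: "S k \<ge> 0" for k by (simp add: S_def sum_nonneg)
  have le: "\<bar>l k i\<bar> \<le> S k" if "i \<in> ?J" for k i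
    unfolding S_def using that finJ by (intro member_le_sum) auto
  \<comment> \<open>Dividing by the sum of absolute values keeps all entries in [-1,1] (also when
    \<open>S k = 0\<close>, where the quotient is 0) and makes their absolute values sum to 1 once
    \<open>S k > 0\<close>.\<close>
  define a where "a k i = l k i / S k" for k i
  have a1: "\<bar>a k i\<bar> \<le> 1" if "i \<in> ?J" for k i
    using le[OF that, of k] S0[of k] by (auto simp: a_def divide_le_eq_1)
  have "bounded (range (\<lambda>k. a k i))" if "i \<in> ?J" for i
    using a1[OF that] by (auto simp: bounded_iff)
  then obtain r \<mu> where r: "strict_mono (r :: nat \<Rightarrow> nat)" and
    \<mu>: "\<And>i. i \<in> ?J \<Longrightarrow> (\<lambda>k. a (r k) i) \<longlonglongrightarrow> \<mu> i"
    using convergent_subseq_finite_family[OF finJ, of a] by blast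
  have Sr: "filterlim (\<lambda>k. S (r k)) at_top sequentially"
    using filterlim_compose[OF S filterlim_subseq[OF r]] .
  have yr: "(\<lambda>k. y (r k)) \<longlonglongrightarrow> z"
    using LIMSEQ_subseq_LIMSEQ[OF y r] by (simp add: o_def)
  note cr = isCont_tendsto_compose[OF cc yr] and nr = isCont_tendsto_compose[OF cn yr]
  have inv0: "(\<lambda>k. inverse (S (r k))) \<longlonglongrightarrow> 0"
    using tendsto_inverse_0_at_top[OF Sr] .
  have Spos: "\<forall>\<^sub>F k in sequentially. S (r k) > 0"
    using Sr unfolding filterlim_at_top_dense by blast
  obtain e where e: "\<And>i. i \<in> I \<Longrightarrow> c i z + nabla (c i) z \<bullet> e > 0"
    "\<And>i. i \<in> E \<Longrightarrow> c i z + nabla (c i) z \<bullet> e = 0"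
    using mfcq_strict_feasible_direction[OF mfcq fin(2)] by blast

  have lim1: "(\<lambda>k. \<Sum>i\<in>?J. a (r k) i * (c i (y (r k)) + nabla (c i) (y (r k)) \<bullet> e)) \<longlonglongrightarrow>
      (\<Sum>i\<in>?J. \<mu> i * (c i z + nabla (c i) z \<bullet> e))"
    by (intro tendsto_intros \<mu> cr nr)
  \<comment> \<open>By \<open>comp\<close>, the term \<open>l k i * c i (y k)\<close> is at most
    minus the multiplier times the slope along \<open>d k\<close>. What remains is the stationarity
    sum paired with \<open>e - d k\<close>, bounded independently of \<open>k\<close>, so it
    vanishes after division by \<open>S (r k)\<close>.\<close>
  have ineq: "(\<Sum>i\<in>?J. l k i * (c i (y k) + nabla (c i) (y k) \<bullet> e)) \<le> Mh * (norm e + Md)" for k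
  proof -
    have "(\<Sum>i\<in>?J. l k i * (c i (y k) + nabla (c i) (y k) \<bullet> e))
        \<le> (\<Sum>i\<in>?J. l k i * (nabla (c i) (y k) \<bullet> e - nabla (c i) (y k) \<bullet> d k))"
      using comp by (intro sum_mono) (simp add: algebra_simps)
    also have "\<dots> = h k \<bullet> (e - d k)"
      by (simp add: stat inner_sum_left flip: inner_diff_right)
    also have "\<dots> \<le> norm (h k) * norm (e - d k)"
      by (rule norm_cauchy_schwarz)
    also have "\<dots> \<le> Mh * (norm e + Md)"
      using h[of k] d[of k] norm_triangle_ineq4[of e "d k"]
        order_trans[OF norm_ge_zero h] by (intro mult_mono) auto
    finally show ?thesis .
  qed
  have "(\<Sum>i\<in>?J. \<mu> i * (c i z + nabla (c i) z \<bullet> e)) \<le> Mh * (norm e + Md) * 0"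
  proof (rule tendsto_le[OF _ _ lim1])
    show "(\<lambda>k. Mh * (norm e + Md) * inverse (S (r k))) \<longlonglongrightarrow> Mh * (norm e + Md) * 0"
      by (intro tendsto_intros inv0)
    show "\<forall>\<^sub>F k in sequentially. (\<Sum>i\<in>?J. a (r k) i * (c i (y (r k)) + nabla (c i) (y (r k)) \<bullet> e))
        \<le> Mh * (norm e + Md) * inverse (S (r k))"
    proof (rule always_eventually, rule allI)
      fix k
      have "(\<Sum>i\<in>?J. a (r k) i * (c i (y (r k)) + nabla (c i) (y (r k)) \<bullet> e))
          = (\<Sum>i\<in>?J. l (r k) i * (c i (y (r k)) + nabla (c i) (y (r k)) \<bullet> e)) * inverse (S (r k))"
        unfolding sum_distrib_right by (intro sum.cong) (simp_all add: a_def field_simps)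
      also have "\<dots> \<le> Mh * (norm e + Md) * inverse (S (r k))"
        using ineq S0 by (intro mult_right_mono) auto
      finally show "(\<Sum>i\<in>?J. a (r k) i * (c i (y (r k)) + nabla (c i) (y (r k)) \<bullet> e))
          \<le> Mh * (norm e + Md) * inverse (S (r k))" .
    qed
  qed simp
  \<comment> \<open>Equality multipliers have no sign, so their terms must vanish exactly; they do,
    since \<open>e\<close> solves the equalities linearized at \<open>z\<close>.\<close>
  also have "(\<Sum>i\<in>?J. \<mu> i * (c i z + nabla (c i) z \<bullet> e)) =
      (\<Sum>i\<in>I. \<mu> i * (c i z + nabla (c i) z \<bullet> e))"
    using e(2) by (intro sum.mono_neutral_right) (auto simp: fin)
  finally have sum0: "(\<Sum>i\<in>I. \<mu> i * (c i z + nabla (c i) z \<bullet> e)) \<le> 0" by simp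
  have \<mu>pos: "\<mu> i \<ge> 0" if "i \<in> I" for i
    using that pos S0 by (intro tendsto_lowerbound[OF \<mu>]) (auto simp: a_def)
  \<comment> \<open>A sum of nonnegative terms that is at most 0 vanishes termwise, and the factor
    of each \<open>\<mu> j\<close> is strictly positive.\<close>
  have \<mu>I: "\<mu> i = 0" if "i \<in> I" for i
  proof -
    have nn: "\<mu> j * (c j z + nabla (c j) z \<bullet> e) \<ge> 0" if "j \<in> I" for j
      using \<mu>pos[OF that] e(1)[OF that] by simp
    have "(\<Sum>j\<in>I. \<mu> j * (c j z + nabla (c j) z \<bullet> e)) = 0"
      using sum0 sum_nonneg[OF nn] by (rule antisym)
    then show ?thesis
      using sum_nonneg_eq_0_iff[OF fin(2) nn] that e(1)[OF that] by auto
  qed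

  \<comment> \<open>The left side \<open>h\<close> of stationarity is bounded, so dividing by
    \<open>S\<close> leaves a vanishing combination of gradients at \<open>z\<close>. Only equality
    gradients survive in it, and these are independent.\<close>
  have "(\<lambda>k. \<Sum>i\<in>?J. a (r k) i *\<^sub>R nabla (c i) (y (r k))) \<longlonglongrightarrow> (\<Sum>i\<in>?J. \<mu> i *\<^sub>R nabla (c i) z)"
    by (intro tendsto_intros \<mu> nr)
  moreover have "(\<lambda>k. \<Sum>i\<in>?J. a (r k) i *\<^sub>R nabla (c i) (y (r k))) \<longlonglongrightarrow> 0"
  proof (rule Lim_null_comparison)
    show "(\<lambda>k. Mh * inverse (S (r k))) \<longlonglongrightarrow> 0"
      using tendsto_mult_left[OF inv0, of Mh] by simp
    have "(\<Sum>i\<in>?J. a k i *\<^sub>R nabla (c i) (y k)) = inverse (S k) *\<^sub>R h k" for k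
      by (simp add: stat scaleR_sum_right a_def divide_inverse_commute)
    then show "\<forall>\<^sub>F k in sequentially. norm (\<Sum>i\<in>?J. a (r k) i *\<^sub>R nabla (c i) (y (r k)))
        \<le> Mh * inverse (S (r k))"
      using h S0 by (auto intro!: always_eventually mult_right_mono simp: mult.commute[of "inverse _"])
  qed
  ultimately have "(\<Sum>i\<in>?J. \<mu> i *\<^sub>R nabla (c i) z) = 0" using LIMSEQ_unique by blast
  moreover have "(\<Sum>i\<in>?J. \<mu> i *\<^sub>R nabla (c i) z) = (\<Sum>i\<in>E. \<mu> i *\<^sub>R nabla (c i) z)"
    using \<mu>I by (intro sum.mono_neutral_right) (auto simp: fin)
  ultimately have \<mu>E: "\<mu> i = 0" if "i \<in> E" for i
    using mfcq that independent_family_sum_zeroD[OF fin(1), of "\<lambda>i. nabla (c i) z" \<mu> i]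
    by (simp add: mfcq_def)

  \<comment> \<open>The normalization survives in the limit and contradicts \<open>\<mu> = 0\<close>
    on \<open>?J\<close>.\<close>
  have "(\<lambda>k. \<Sum>i\<in>?J. \<bar>a (r k) i\<bar>) \<longlonglongrightarrow> (\<Sum>i\<in>?J. \<bar>\<mu> i\<bar>)"
    by (intro tendsto_intros \<mu>)
  moreover have "\<forall>\<^sub>F k in sequentially. (\<Sum>i\<in>?J. \<bar>a (r k) i\<bar>) = 1"
    using Spos
  proof eventually_elim
    case (elim k)
    have "(\<Sum>i\<in>?J. \<bar>a (r k) i\<bar>) = (\<Sum>i\<in>?J. \<bar>l (r k) i\<bar>) / S (r k)"
      by (simp add: a_def abs_divide S0 sum_divide_distrib)
    then show ?case using elim by (simp flip: S_def)
  qed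
  ultimately have "(\<Sum>i\<in>?J. \<bar>\<mu> i\<bar>) = 1"
    by (rule LIMSEQ_unique[OF _ tendsto_eventually])
  moreover have "(\<Sum>i\<in>?J. \<bar>\<mu> i\<bar>) = 0" using \<mu>I \<mu>E by (intro sum.neutral) auto
  ultimately show False by simp
qed

section \<open>The line search\<close>

lemma neg_part_nonneg: "neg_part y \<ge> 0"
  by (simp add: neg_part_def)

lemma viol_nonneg: "viol E I c y \<ge> 0"
  unfolding viol_def by (intro add_nonneg_nonneg sum_nonneg) (auto simp: neg_part_nonneg)

text \<open>Up to the Taylor error \<open>R\<close>, each constraint at the trial point is a convex
  combination of its value and its linearization at \<open>x\<close>. Convexity of the absolute
  value and of \<open>neg_part\<close> separates the two, and the slacks bound the linearized
  violation.\<close>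

lemma viol_step_le:
  fixes c :: "'i \<Rightarrow> real^'n \<Rightarrow> real" and H :: real
  assumes ca: "constraint_assms E I c H" and qp: "qp_feasible E I c x d v w t"
    and s: "0 \<le> s" "s \<le> 1"
  shows "viol E I c (x + s *\<^sub>R d) \<le> (1 - s) * viol E I c x
      + s * ((\<Sum>i\<in>E. v i + w i) + (\<Sum>i\<in>I. t i))
      + real (card E + card I) * (H / 2 * (s\<^sup>2 * (norm d)\<^sup>2))"
proof -
  define R where "R = H / 2 * (s\<^sup>2 * (norm d)\<^sup>2)"
  have taylor: "\<bar>c i (x + s *\<^sub>R d) - ((1 - s) * c i x + s * (c i x + nabla (c i) x \<bullet> d))\<bar> \<le> R"
    if "i \<in> E \<union> I" for i
  proof -
    have "\<bar>c i (x + s *\<^sub>R d) - c i x - nabla (c i) x \<bullet> (x + s *\<^sub>R d - x)\<bar>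
        \<le> H / 2 * (norm (x - (x + s *\<^sub>R d)))\<^sup>2"
      using ca that unfolding constraint_assms_def by blast
    then show ?thesis by (simp add: R_def power_mult_distrib algebra_simps)
  qed
  have E: "\<bar>c i (x + s *\<^sub>R d)\<bar> \<le> (1 - s) * \<bar>c i x\<bar> + s * (v i + w i) + R" if "i \<in> E" for i
  proof -
    have "\<bar>c i x + nabla (c i) x \<bullet> d\<bar> \<le> v i + w i"
      using qp that unfolding qp_feasible_def by force
    then have "\<bar>s * (c i x + nabla (c i) x \<bullet> d)\<bar> \<le> s * (v i + w i)"
      using s by (simp add: abs_mult mult_left_mono)
    moreover have "\<bar>(1 - s) * c i x\<bar> = (1 - s) * \<bar>c i x\<bar>"
      using s by (simp add: abs_mult)
    ultimately show ?thesis using taylor[of i] that by auto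
  qed
  have I: "neg_part (c i (x + s *\<^sub>R d)) \<le> (1 - s) * neg_part (c i x) + s * t i + R" if "i \<in> I" for i
  proof -
    have t: "- (c i x + nabla (c i) x \<bullet> d) \<le> t i" "0 \<le> t i"
      using qp that unfolding qp_feasible_def by force+
    have "- (s * (c i x + nabla (c i) x \<bullet> d)) \<le> s * t i"
      using mult_left_mono[OF t(1) s(1)] by (simp add: algebra_simps)
    moreover have "- ((1 - s) * c i x) \<le> (1 - s) * neg_part (c i x)"
      using mult_left_mono[of "- c i x" "neg_part (c i x)" "1 - s"] s
      by (simp add: neg_part_def)
    moreover have "(1 - s) * neg_part (c i x) \<ge> 0" "s * t i \<ge> 0"
      using s t(2) neg_part_nonneg by auto
    ultimately show ?thesis using taylor[of i] that by (auto simp: neg_part_def)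
  qed
  have "viol E I c (x + s *\<^sub>R d) \<le> (\<Sum>i\<in>E. (1 - s) * \<bar>c i x\<bar> + s * (v i + w i) + R)
      + (\<Sum>i\<in>I. (1 - s) * neg_part (c i x) + s * t i + R)"
    unfolding viol_def by (intro add_mono sum_mono E I)
  also have "\<dots> = (1 - s) * viol E I c x + s * ((\<Sum>i\<in>E. v i + w i) + (\<Sum>i\<in>I. t i))
      + real (card E + card I) * R"
    by (simp add: viol_def sum.distrib sum_subtractf sum_distrib_left algebra_simps)
  finally show ?thesis unfolding R_def .
qed

text \<open>The solution is compared with the zero step, whose slacks are the positive and negative
  parts of the constraint values; the model there costs exactly the penalized violation. Finiteness
  of \<open>f x\<close> allows cancelling it.\<close>

lemma qp_solution_model_decrease:
  assumes qp: "qp_solution f E I c x g B \<theta> d v w t" and fx: "\<bar>f x\<bar> \<noteq> \<infinity>"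
  shows "g \<bullet> d + 1/2 * (d \<bullet> (B *v d)) + \<theta> * ((\<Sum>i\<in>E. v i + w i) + (\<Sum>i\<in>I. t i))
    \<le> \<theta> * viol E I c x"
proof -
  let ?v = "\<lambda>i. max 0 (c i x)" and ?w = "\<lambda>i. max 0 (- c i x)" and ?t = "\<lambda>i. neg_part (c i x)"
  have "qp_feasible E I c x 0 ?v ?w ?t"
    by (auto simp: qp_feasible_def neg_part_def)
  then have "qp_objective f E I x g B \<theta> d v w t \<le> qp_objective f E I x g B \<theta> 0 ?v ?w ?t"
    using qp unfolding qp_solution_def by blast
  moreover obtain a where "f x = ereal a" using fx by auto
  moreover have "(\<Sum>i\<in>E. ?v i + ?w i) = (\<Sum>i\<in>E. \<bar>c i x\<bar>)"
    by (intro sum.cong) auto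
  ultimately show ?thesis
    unfolding qp_objective_def viol_def by (simp add: algebra_simps)
qed

lemma sufficient_decrease_iff_real:
  assumes "\<bar>f x\<bar> \<noteq> \<infinity>" and "\<bar>f (x + s *\<^sub>R d)\<bar> \<noteq> \<infinity>"
  shows "sufficient_decrease f E I c \<eta> x B \<theta> d s \<longleftrightarrow>
    real_of_ereal (f (x + s *\<^sub>R d)) + \<theta> * viol E I c (x + s *\<^sub>R d) + \<eta> * s / 2 * (d \<bullet> (B *v d))
      \<le> real_of_ereal (f x) + \<theta> * viol E I c x"
proof -
  obtain a a' where "f x = ereal a" "f (x + s *\<^sub>R d) = ereal a'" using assms by auto
  then show ?thesis by (auto simp: sufficient_decrease_def merit_def algebra_simps)
qed

text \<open>With q the curvature term \<open>d \<bullet> (B *v d)\<close>, the model decrease lowers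
  the merit function by s*q/2 up to second-order errors from \<open>f\<close> and from the
  constraints. By \<open>small\<close> and \<open>curv\<close> these errors are at most the fraction
  \<open>1 - \<eta>\<close> of that decrease.\<close>

lemma sufficient_decrease_small_step:
  fixes c :: "'i \<Rightarrow> real^'n \<Rightarrow> real" and H :: real
  assumes ca: "constraint_assms E I c H"
    and qp: "qp_solution f E I c x g B \<theta> d v w t"
    and fx: "\<bar>f x\<bar> \<noteq> \<infinity>" "\<bar>f (x + s *\<^sub>R d)\<bar> \<noteq> \<infinity>"
    and descent: "f (x + s *\<^sub>R d) - f x - ereal (g \<bullet> (s *\<^sub>R d)) \<le> ereal (\<rho> / 2 * (norm (s *\<^sub>R d))\<^sup>2)"
    and curv: "d \<bullet> (B *v d) \<ge> b * (norm d)\<^sup>2"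
    and s: "0 \<le> s" "s \<le> 1" and "\<theta> \<ge> 0" and "\<eta> \<le> 1"
    and small: "s * (\<rho> + \<theta> * (real (card E + card I) * H)) \<le> (1 - \<eta>) * b"
  shows "sufficient_decrease f E I c \<eta> x B \<theta> d s"
proof -
  obtain a a' where a: "f x = ereal a" "f (x + s *\<^sub>R d) = ereal a'" using fx by auto
  define m where "m = real (card E + card I)"
  define V where "V = (\<Sum>i\<in>E. v i + w i) + (\<Sum>i\<in>I. t i)"
  define q where "q = d \<bullet> (B *v d)"
  define n where "n = (norm d)\<^sup>2"
  have feas: "qp_feasible E I c x d v w t" using qp by (simp add: qp_solution_def)
  have "a' - a \<le> s * (g \<bullet> d) + \<rho> / 2 * (s\<^sup>2 * n)"
    using descent s by (simp add: a n_def power_mult_distrib)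
  moreover have "\<theta> * viol E I c (x + s *\<^sub>R d)
      \<le> \<theta> * ((1 - s) * viol E I c x + s * V + m * (H / 2 * (s\<^sup>2 * n)))"
    using viol_step_le[OF ca feas s] \<open>\<theta> \<ge> 0\<close> unfolding m_def V_def n_def by (rule mult_left_mono)
  moreover have "s * (g \<bullet> d + 1/2 * q + \<theta> * V) \<le> s * (\<theta> * viol E I c x)"
    using qp_solution_model_decrease[OF qp fx(1)] s(1) unfolding V_def q_def
    by (rule mult_left_mono)
  moreover have "(s * n) * (s * (\<rho> + \<theta> * (m * H))) \<le> (s * n) * ((1 - \<eta>) * b)"
    using small s(1) unfolding m_def n_def by (intro mult_left_mono) auto
  moreover have "(s * (1 - \<eta>)) * (b * n) \<le> (s * (1 - \<eta>)) * q"
    using curv s(1) \<open>\<eta> \<le> 1\<close> unfolding n_def q_def by (intro mult_left_mono) auto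
  ultimately have "a' + \<theta> * viol E I c (x + s *\<^sub>R d) + \<eta> * s / 2 * q \<le> a + \<theta> * viol E I c x"
    by (simp add: algebra_simps power2_eq_square)
  then show ?thesis
    unfolding sufficient_decrease_iff_real[OF fx] by (simp add: a q_def)
qed

section \<open>Convergence\<close>

text \<open>Dropping finitely many terms keeps a sequence unbounded, so increasing indices with
  \<open>S (r n) \<ge> real n\<close> can be chosen.\<close>

lemma unbounded_imp_subseq_at_top:
  fixes S :: "nat \<Rightarrow> real"
  assumes "\<not> bdd_above (range S)"
  shows "\<exists>r. strict_mono r \<and> filterlim (\<lambda>n. S (r n)) at_top sequentially"
proof -
  have ex: "\<exists>k'>k. S k' \<ge> C" for k C
  proof (rule ccontr)
    assume "\<not> (\<exists>k'>k. S k' \<ge> C)"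
    then have "S j \<le> C" if "j \<in> {k<..}" for j using that by force
    then have "bdd_above (S ` {k<..})" by (rule bdd_aboveI2)
    moreover have "bdd_above (S ` {..k})" by (simp add: bdd_above_finite)
    ultimately have "bdd_above (S ` ({..k} \<union> {k<..}))" by (simp add: image_Un)
    moreover have "{..k} \<union> {k<..} = UNIV" by auto
    ultimately show False using assms by simp
  qed
  have "\<exists>r. \<forall>n. S (r n) \<ge> real n \<and> r n < r (Suc n)"
    by (rule dependent_nat_choice) (use ex in \<open>blast+\<close>)
  then obtain r where r: "\<And>n. S (r n) \<ge> real n" "\<And>n. r n < r (Suc n)" by blast
  have "filterlim (\<lambda>n. S (r n)) at_top sequentially"
    using r(1) by (intro filterlim_at_top_mono[OF filterlim_real_sequentially] always_eventually) auto
  then show ?thesis using r(2) by (auto simp: strict_mono_Suc_iff)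
qed

text \<open>Complementarity makes the product \<open>- l i * t i\<close> for inequalities and
  \<open>- \<theta> * (v i + w i)\<close> for equalities. This one sign serves both the bound on the
  multipliers and complementarity in the limit.\<close>

lemma qp_multiplier_mult_linearized_le:
  assumes mult: "qp_multiplier E I c x g B \<theta> d v w t l"
    and feas: "qp_feasible E I c x d v w t" and "\<theta> \<ge> 0" and "i \<in> E \<union> I"
  shows "l i * (c i x + nabla (c i) x \<bullet> d) \<le> 0"
proof (cases "i \<in> I")
  case True
  then have "l i \<ge> 0" "l i * (c i x + nabla (c i) x \<bullet> d + t i) = 0" "t i \<ge> 0"
    using mult feas unfolding qp_multiplier_def qp_feasible_def by blast+
  then have "l i * (c i x + nabla (c i) x \<bullet> d) = - (l i * t i)" by (simp add: algebra_simps)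
  then show ?thesis using \<open>l i \<ge> 0\<close> \<open>t i \<ge> 0\<close> by simp
next
  case False
  then have i: "i \<in> E" using assms(4) by blast
  have lin: "c i x + nabla (c i) x \<bullet> d = v i - w i" "v i \<ge> 0" "w i \<ge> 0"
    using feas i unfolding qp_feasible_def by blast+
  have "(\<theta> + l i) * v i = 0" "(\<theta> - l i) * w i = 0"
    using mult i unfolding qp_multiplier_def by auto
  then have "l i * (c i x + nabla (c i) x \<bullet> d) = - (\<theta> * (v i + w i))"
    by (auto simp: lin algebra_simps)
  then show ?thesis using \<open>\<theta> \<ge> 0\<close> lin by simp
qed

lemma inf_norm_on_le_sum:
  assumes "finite J"
  shows "inf_norm_on J l \<le> (\<Sum>i\<in>J. \<bar>l i\<bar>)"
  unfolding inf_norm_on_def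
  using assms by (auto simp: sum_nonneg intro!: member_le_sum)

theorem theorem3p12:
  fixes E I :: "'i set"
    and c :: "'i \<Rightarrow> real^'n \<Rightarrow> real"
    and f :: "real^'n \<Rightarrow> ereal"
    and D :: "(real^'n) set"
    and \<rho> H b \<eta> \<tau> \<gamma> :: real
    and x g d :: "nat \<Rightarrow> real^'n"
    and B :: "nat \<Rightarrow> real^'n^'n"
    and \<theta> \<alpha> :: "nat \<Rightarrow> real"
    and v w t l :: "nat \<Rightarrow> 'i \<Rightarrow> real"
  assumes "finite E" and "finite I" and "E \<inter> I = {}"
    and "\<And>y. f y \<noteq> - \<infinity>"
    and "objective_assms TYPE('t) f D \<rho>"
    and "constraint_assms E I c H"
    and "iterate_assms E I c D x d B b"
    and "sqp_run f E I c \<eta> \<tau> \<gamma> x g B \<theta> d v w t l \<alpha>"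
    and "\<And>z. accumulation_point x z \<Longrightarrow> mfcq E I c z"
  shows "\<forall>xbar. accumulation_point x xbar \<longrightarrow>
    (\<exists>(s :: nat \<Rightarrow> nat) lbar.
       strict_mono s \<and> (\<lambda>j. x (s j)) \<longlonglongrightarrow> xbar \<and>
       0 \<in> (\<lambda>h. h - (\<Sum>i\<in>E \<union> I. lbar i *\<^sub>R nabla (c i) xbar)) ` clarke_subdiff f xbar \<and>
       (\<forall>i\<in>E. c i xbar = 0) \<and>
       (\<forall>i\<in>I. c i xbar \<ge> 0 \<and> lbar i \<ge> 0 \<and> lbar i * c i xbar = 0))"
proof (intro allI impI)
  fix xbar assume acc: "accumulation_point x xbar"
  let ?J = "E \<union> I"
  define F where "F y = real_of_ereal (f y)" for y
  define m where "m = real (card E + card I)"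

  have finJ: "finite ?J" using assms(1,2) by simp
  obtain S where "open S \<and> D \<subseteq> S \<and> (\<forall>y\<in>S. \<bar>f y\<bar> \<noteq> \<infinity>) \<and>
      (\<exists>L. L-lipschitz_on S (\<lambda>y. real_of_ereal (f y))) \<and> upper_C2_on TYPE('t) S f"
    using assms(5)[unfolded objective_assms_def, THEN conjunct1] ..
  then obtain L where S: "open S" "D \<subseteq> S" and fS: "\<And>y. y \<in> S \<Longrightarrow> \<bar>f y\<bar> \<noteq> \<infinity>"
    and lip: "L-lipschitz_on S (\<lambda>y. real_of_ereal (f y))"
    by (elim conjE exE, intro that; simp)
  have "\<rho> > 0" and descent: "\<And>y z h. y \<in> D \<Longrightarrow> z \<in> D \<Longrightarrow> h \<in> clarke_subdiff f z \<Longrightarrow>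
      f y - f z - ereal (h \<bullet> (y - z)) \<le> ereal (\<rho> / 2 * (norm (y - z))\<^sup>2)"
    using assms(5) unfolding objective_assms_def by blast+
  have "H \<ge> 0" and cc: "\<And>i y. i \<in> ?J \<Longrightarrow> isCont (c i) y"
    and cn: "\<And>i y. i \<in> ?J \<Longrightarrow> isCont (nabla (c i)) y"
    using assms(6) unfolding constraint_assms_def
    by (blast intro: differentiable_imp_continuous_within,
        blast intro: differentiable_imp_continuous_within,
        metis UNIV_I continuous_on_eq_continuous_at open_UNIV)
  have D: "compact D" "convex D" and xD: "\<And>k. x k \<in> D" and xdD: "\<And>k. x k + d k \<in> D"
    and "b > 0" and Bb: "bounded (range B)"
    and curv: "\<And>k y. y \<bullet> (B k *v y) \<ge> b * (norm y)\<^sup>2"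
    using assms(7) unfolding iterate_assms_def by blast+
  have \<theta>0: "\<theta> 0 > 0" and \<eta>: "0 < \<eta>" "\<eta> < 1" and \<tau>: "0 < \<tau>" "\<tau> < 1"
    and g: "\<And>k. g k \<in> clarke_subdiff f (x k)"
    and qp: "\<And>k. qp_solution f E I c (x k) (g k) (B k) (\<theta> k) (d k) (v k) (w k) (t k)"
    and mult: "\<And>k. qp_multiplier E I c (x k) (g k) (B k) (\<theta> k) (d k) (v k) (w k) (t k) (l (Suc k))"
    and \<theta>Suc: "\<And>k. \<theta> (Suc k) = max (\<theta> k) (inf_norm_on ?J (l (Suc k)) + \<gamma>)"
    and step: "\<And>k. \<exists>j. \<alpha> k = \<tau> ^ j \<and>
             sufficient_decrease f E I c \<eta> (x k) (B k) (\<theta> k) (d k) (\<tau> ^ j) \<and>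
             (\<forall>j'<j. \<not> sufficient_decrease f E I c \<eta> (x k) (B k) (\<theta> k) (d k) (\<tau> ^ j'))"
    and xSuc: "\<And>k. x (Suc k) = x k + \<alpha> k *\<^sub>R d k"
    using assms(8) unfolding sqp_run_def by blast+
  have feas: "qp_feasible E I c (x k) (d k) (v k) (w k) (t k)" for k
    using qp unfolding qp_solution_def by blast
  have \<theta>mono: "\<theta> k \<le> \<theta> (Suc k)" for k by (simp add: \<theta>Suc)
  have \<theta>pos: "\<theta> k > 0" for k
    by (induction k) (use \<theta>0 \<theta>mono less_le_trans in blast)+
  have stat: "g k + B k *v d k = (\<Sum>i\<in>?J. l (Suc k) i *\<^sub>R nabla (c i) (x k))"
    and lpos: "\<And>i. i \<in> I \<Longrightarrow> l (Suc k) i \<ge> 0" for k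
    using mult[of k] unfolding qp_multiplier_def by auto
  note comp = qp_multiplier_mult_linearized_le[OF mult feas less_imp_le[OF \<theta>pos]]

  \<comment> \<open>A priori bounds on steps and subgradients\<close>
  obtain M0 where M0: "\<And>y. y \<in> D \<Longrightarrow> norm y \<le> M0"
    using compact_imp_bounded[OF D(1)] unfolding bounded_iff by blast
  have dM: "norm (d k) \<le> M0 + M0" for k
    using M0[OF xD[of k]] M0[OF xdD[of k]] norm_triangle_ineq4[of "x k + d k" "x k"] by simp
  have gL: "norm (g k) \<le> L" for k
    using clarke_subdiff_norm_le_lipschitz[OF S(1) _ fS lip g] S(2) xD by blast
  obtain K where K: "K \<ge> 0" "\<And>k y. norm (B k *v y) \<le> K * norm y"
    using bounded_matrices_imp_uniform_bound[OF Bb] by blast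
  have hM: "norm (g k + B k *v d k) \<le> L + K * (M0 + M0)" for k
    using gL[of k] K(2)[of k "d k"] mult_left_mono[OF dM[of k] K(1)]
      norm_triangle_ineq[of "g k" "B k *v d k"] by linarith

  \<comment> \<open>Boundedness of the multipliers and of the penalty parameters\<close>
  have "bdd_above (range (\<lambda>k. \<Sum>i\<in>?J. \<bar>l (Suc k) i\<bar>))"
  proof (rule ccontr)
    assume "\<not> ?thesis"
    from unbounded_imp_subseq_at_top[OF this] obtain r where r: "strict_mono (r :: nat \<Rightarrow> nat)"
      and top: "filterlim (\<lambda>k. \<Sum>i\<in>?J. \<bar>l (Suc (r k)) i\<bar>) at_top sequentially"
      by auto
    \<comment> \<open>Compactness of \<open>D\<close> refines the blow-up subsequence so that the
      iterates converge; their limit is an accumulation point, where MFCQ is available.\<close>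
    obtain z q where q: "strict_mono (q :: nat \<Rightarrow> nat)" "(\<lambda>k. x (r (q k))) \<longlonglongrightarrow> z"
      using D(1)[unfolded compact_def, rule_format, of "x \<circ> r"] xD by (auto simp: o_def)
    have "accumulation_point x z"
      unfolding accumulation_point_iff_subseq
      using strict_mono_o[OF r q(1)] q(2) by (intro exI[of _ "r \<circ> q"]) simp
    from mfcq_multipliers_not_at_top[OF assms(1,2) assms(9)[OF this] q(2) cc cn stat hM dM lpos comp]
    show False
      using filterlim_compose[OF top filterlim_subseq[OF q(1)]] by simp
  qed
  then obtain M where M: "\<And>k. (\<Sum>i\<in>?J. \<bar>l (Suc k) i\<bar>) \<le> M"
    unfolding bdd_above_def by auto
  have lM: "\<bar>l (Suc k) i\<bar> \<le> M" if "i \<in> ?J" for k i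
    using that finJ M[of k] member_le_sum[of i ?J "\<lambda>i. \<bar>l (Suc k) i\<bar>"] by simp

  define T where "T = max (\<theta> 0) (M + \<gamma>)"
  have \<theta>T: "\<theta> k \<le> T" for k
  proof (induction k)
    case (Suc k)
    then show ?case
      using inf_norm_on_le_sum[OF finJ, of "l (Suc k)"] M[of k] by (simp add: \<theta>Suc T_def)
  qed (simp add: T_def)

  \<comment> \<open>Step sizes bounded away from zero\<close>
  have \<alpha>01: "0 < \<alpha> k" "\<alpha> k \<le> 1" for k
    using step[of k] \<tau> by (auto simp: power_le_one)
  have segD: "x k + s *\<^sub>R d k \<in> D" if "0 \<le> s" "s \<le> 1" for k s
    using convexD_alt[OF D(2) xD[of k] xdD[of k] that] by (simp add: algebra_simps)
  note fD = fS[OF subsetD[OF S(2)]]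

  \<comment> \<open>\<open>C\<close> bounds the coefficient of the step size in
    \<open>sufficient_decrease_small_step\<close> uniformly in \<open>k\<close>, so every trial step
    up to \<open>(1 - \<eta>) * b / C\<close> is accepted.\<close>
  define C where "C = \<rho> + T * (m * H)"
  have "T > 0" using \<theta>0 by (simp add: T_def)
  then have "C > 0" using \<open>\<rho> > 0\<close> \<open>H \<ge> 0\<close> by (simp add: C_def m_def add_pos_nonneg)
  define amin where "amin = min 1 (\<tau> * ((1 - \<eta>) * b / C))"
  have "amin > 0" using \<tau> \<eta> \<open>b > 0\<close> \<open>C > 0\<close> by (simp add: amin_def)
  have \<alpha>amin: "amin \<le> \<alpha> k" for k
  proof -
    obtain j where j: "\<alpha> k = \<tau> ^ j"
      "\<And>j'. j' < j \<Longrightarrow> \<not> sufficient_decrease f E I c \<eta> (x k) (B k) (\<theta> k) (d k) (\<tau> ^ j')"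
      using step by blast
    show ?thesis
    proof (cases j)
      case 0
      then show ?thesis using j(1) by (simp add: amin_def)
    next
      \<comment> \<open>The previous trial \<open>\<tau> ^ j'\<close> was rejected, hence lies above
        the acceptance threshold; the accepted step is \<open>\<tau>\<close> times it, which
        explains the factor in \<open>amin\<close>.\<close>
      case (Suc j')
      define s where "s = \<tau> ^ j'"
      have s: "0 \<le> s" "s \<le> 1" using \<tau> by (auto simp: s_def power_le_one)
      have "\<not> s * (\<rho> + \<theta> k * (m * H)) \<le> (1 - \<eta>) * b"
      proof
        assume "s * (\<rho> + \<theta> k * (m * H)) \<le> (1 - \<eta>) * b"
        moreover have "f (x k + s *\<^sub>R d k) - f (x k) - ereal (g k \<bullet> (s *\<^sub>R d k))
            \<le> ereal (\<rho> / 2 * (norm (s *\<^sub>R d k))\<^sup>2)"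
          using descent[OF segD[OF s] xD g, of k k] by simp
        ultimately have "sufficient_decrease f E I c \<eta> (x k) (B k) (\<theta> k) (d k) s"
          using sufficient_decrease_small_step[OF assms(6) qp fD[OF xD] fD[OF segD[OF s]] _ curv s
              less_imp_le[OF \<theta>pos] less_imp_le[OF \<eta>(2)]]
          by (simp add: m_def)
        then show False using j(2)[of j'] Suc by (simp add: s_def)
      qed
      moreover have "s * (\<rho> + \<theta> k * (m * H)) \<le> s * C"
        unfolding C_def using \<theta>T[of k] s(1) \<open>H \<ge> 0\<close>
        by (intro mult_left_mono add_left_mono mult_right_mono) (auto simp: m_def)
      ultimately have "(1 - \<eta>) * b / C \<le> s"
        using \<open>C > 0\<close> by (simp add: pos_divide_le_eq)
      then have "\<tau> * ((1 - \<eta>) * b / C) \<le> \<tau> * s"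
        using \<tau> by (intro mult_left_mono) auto
      then show ?thesis using j(1) Suc by (simp add: amin_def s_def)
    qed
  qed

  \<comment> \<open>Vanishing of the steps\<close>
  have "continuous_on D (viol E I c)"
    unfolding viol_def[abs_def] neg_part_def
    by (intro continuous_intros) (auto intro!: cc continuous_at_imp_continuous_on)
  from compact_imp_bounded[OF compact_continuous_image[OF this D(1)]]
  obtain V where "\<forall>r\<in>viol E I c ` D. norm r \<le> V"
    unfolding bounded_iff ..
  then have V: "viol E I c y \<le> V" if "y \<in> D" for y
    using that by (auto simp: abs_le_iff)
  have "V \<ge> 0" using V[OF xD] viol_nonneg order_trans by blast
  have "continuous_on D F"
    unfolding F_def using lipschitz_on_continuous_on[OF lip] S(2) continuous_on_subset by blast
  from compact_imp_bounded[OF compact_continuous_image[OF this D(1)]]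
  obtain MF where "\<forall>r\<in>F ` D. norm r \<le> MF"
    unfolding bounded_iff ..
  then have MF: "\<bar>F y\<bar> \<le> MF" if "y \<in> D" for y
    using that by simp

  text \<open>Subtracting \<open>\<theta> k * V\<close> makes the merit values decrease in spite of the penalty updates.\<close>
  define P where "P k = F (x k) + \<theta> k * (viol E I c (x k) - V)" for k
  have "(\<lambda>k. (norm (d k))\<^sup>2) \<longlonglongrightarrow> 0"
  proof (rule sufficient_decrease_imp_null)
    show "\<eta> * amin / 2 * b > 0" using \<eta> \<open>amin > 0\<close> \<open>b > 0\<close> by simp
    \<comment> \<open>Here the bound \<open>T\<close> on the penalty parameters is essential: it
      limits the subtracted term \<open>\<theta> k * V\<close>.\<close>
    show "P k \<ge> - MF - T * V" for k
    proof -
      have "\<theta> k * viol E I c (x k) \<ge> 0"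
        by (intro mult_nonneg_nonneg less_imp_le[OF \<theta>pos] viol_nonneg)
      then show ?thesis
        using MF[OF xD[of k]] mult_right_mono[OF \<theta>T[of k] \<open>V \<ge> 0\<close>]
        by (simp add: P_def right_diff_distrib abs_le_iff)
    qed
    show "P (Suc k) \<le> P k - \<eta> * amin / 2 * b * (norm (d k))\<^sup>2" for k
    proof -
      have "sufficient_decrease f E I c \<eta> (x k) (B k) (\<theta> k) (d k) (\<alpha> k)"
        using step by metis
      then have "F (x (Suc k)) + \<theta> k * viol E I c (x (Suc k)) + \<eta> * \<alpha> k / 2 * (d k \<bullet> (B k *v d k))
          \<le> F (x k) + \<theta> k * viol E I c (x k)"
        unfolding sufficient_decrease_iff_real[OF fD[OF xD]
            fD[OF segD[OF less_imp_le[OF \<alpha>01(1)] \<alpha>01(2)]]]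
        by (simp add: F_def xSuc)
      \<comment> \<open>The violation is at most \<open>V\<close>, so raising the penalty multiplies
        a nonpositive number by a larger factor.\<close>
      moreover have "\<theta> (Suc k) * (viol E I c (x (Suc k)) - V) \<le> \<theta> k * (viol E I c (x (Suc k)) - V)"
        using \<theta>mono V[OF xD] by (intro mult_right_mono_neg) auto
      moreover have "\<eta> * amin / 2 * (b * (norm (d k))\<^sup>2) \<le> \<eta> * \<alpha> k / 2 * (d k \<bullet> (B k *v d k))"
        using \<eta> \<alpha>amin[of k] \<open>amin > 0\<close> \<open>b > 0\<close> curv by (intro mult_mono) auto
      ultimately show ?thesis by (simp add: P_def algebra_simps)
    qed
  qed simp
  from tendsto_real_sqrt[OF this] have d0: "d \<longlonglongrightarrow> 0"
    by (simp add: tendsto_norm_zero_iff)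

  \<comment> \<open>Passage to the limit in the optimality conditions\<close>
  obtain s0 where s0: "strict_mono (s0 :: nat \<Rightarrow> nat)" "(\<lambda>k. x (s0 k)) \<longlonglongrightarrow> xbar"
    using acc unfolding accumulation_point_iff_subseq by blast
  have "bounded (range (\<lambda>k. l (Suc (s0 k)) i))" if "i \<in> ?J" for i
    using lM[OF that] by (auto simp: bounded_iff)
  then obtain r1 lbar where r1: "strict_mono (r1 :: nat \<Rightarrow> nat)"
    and lbar1: "\<And>i. i \<in> ?J \<Longrightarrow> (\<lambda>k. l (Suc (s0 (r1 k))) i) \<longlonglongrightarrow> lbar i"
    using convergent_subseq_finite_family[OF finJ, of "\<lambda>k. l (Suc (s0 k))"] by blast
  have "bounded (range (\<lambda>k. g (s0 (r1 k))))" using gL by (auto simp: bounded_iff)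
  then obtain gbar r2 where r2: "strict_mono (r2 :: nat \<Rightarrow> nat)"
    and gbar: "(\<lambda>k. g (s0 (r1 (r2 k)))) \<longlonglongrightarrow> gbar"
    using bounded_imp_convergent_subsequence[of "\<lambda>k. g (s0 (r1 k))"] by (auto simp: o_def)
  define s where "s k = s0 (r1 (r2 k))" for k
  have s: "strict_mono s"
    using strict_mono_o[OF s0(1) strict_mono_o[OF r1 r2]] by (simp add: s_def[abs_def] o_def)
  have xs: "(\<lambda>k. x (s k)) \<longlonglongrightarrow> xbar"
    using LIMSEQ_subseq_LIMSEQ[OF s0(2) strict_mono_o[OF r1 r2]] by (simp add: s_def o_def)
  have ds: "(\<lambda>k. d (s k)) \<longlonglongrightarrow> 0"
    using LIMSEQ_subseq_LIMSEQ[OF d0 s] by (simp add: o_def)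
  have ls: "(\<lambda>k. l (Suc (s k)) i) \<longlonglongrightarrow> lbar i" if "i \<in> ?J" for i
    using LIMSEQ_subseq_LIMSEQ[OF lbar1[OF that] r2] by (simp add: s_def o_def)
  have gs: "(\<lambda>k. g (s k)) \<longlonglongrightarrow> gbar" using gbar by (simp add: s_def)
  note cs = isCont_tendsto_compose[OF cc xs] and ns = isCont_tendsto_compose[OF cn xs]

  \<comment> \<open>The matrices need not converge; their uniform bound and \<open>ds\<close>
    suffice.\<close>
  have "(\<lambda>k. B (s k) *v d (s k)) \<longlonglongrightarrow> 0"
  proof (rule Lim_null_comparison[OF always_eventually])
    show "\<forall>k. norm (B (s k) *v d (s k)) \<le> K * norm (d (s k))" using K(2) by blast
    show "(\<lambda>k. K * norm (d (s k))) \<longlonglongrightarrow> 0"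
      using tendsto_mult_left[OF tendsto_norm_zero[OF ds], of K] by simp
  qed
  from tendsto_add[OF gs this]
  have "(\<lambda>k. \<Sum>i\<in>?J. l (Suc (s k)) i *\<^sub>R nabla (c i) (x (s k))) \<longlonglongrightarrow> gbar"
    by (simp add: stat)
  moreover have "(\<lambda>k. \<Sum>i\<in>?J. l (Suc (s k)) i *\<^sub>R nabla (c i) (x (s k))) \<longlonglongrightarrow>
      (\<Sum>i\<in>?J. lbar i *\<^sub>R nabla (c i) xbar)"
    by (intro tendsto_intros ls ns)
  ultimately have gbar_eq: "gbar = (\<Sum>i\<in>?J. lbar i *\<^sub>R nabla (c i) xbar)"
    using LIMSEQ_unique by blast
  have "gbar \<in> clarke_subdiff f xbar"
    using clarke_subdiff_closed_graph[OF g xs gs] .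
  then have kkt: "0 \<in> (\<lambda>h. h - (\<Sum>i\<in>?J. lbar i *\<^sub>R nabla (c i) xbar)) ` clarke_subdiff f xbar"
    using gbar_eq by (intro image_eqI[of _ _ gbar]) auto

  \<comment> \<open>Feasibility of the limit is part of MFCQ there and is not derived from the
    algorithm.\<close>
  have feasible: "xbar \<in> feasible_set E I c"
    using assms(9)[OF acc] by (simp add: mfcq_def)
  have lbar0: "lbar i \<ge> 0" if "i \<in> I" for i
    using that lpos by (intro tendsto_lowerbound[OF ls]) auto
  \<comment> \<open>The limit of \<open>comp\<close> with vanishing steps gives only one inequality;
    feasibility and the sign of \<open>lbar i\<close> give the other.\<close>
  have "lbar i * c i xbar = 0" if "i \<in> I" for i
  proof -
    have "(\<lambda>k. l (Suc (s k)) i * (c i (x (s k)) + nabla (c i) (x (s k)) \<bullet> d (s k)))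
        \<longlonglongrightarrow> lbar i * (c i xbar + nabla (c i) xbar \<bullet> 0)"
      using that by (intro tendsto_intros ls cs ns ds) auto
    then have "lbar i * (c i xbar + nabla (c i) xbar \<bullet> 0) \<le> 0"
      using that comp by (intro tendsto_upperbound[where F = sequentially]) auto
    moreover have "lbar i * c i xbar \<ge> 0"
      using that lbar0 feasible by (simp add: feasible_set_def)
    ultimately show ?thesis by simp
  qed
  then have "\<forall>i\<in>I. c i xbar \<ge> 0 \<and> lbar i \<ge> 0 \<and> lbar i * c i xbar = 0"
    using feasible lbar0 by (simp add: feasible_set_def)
  then show "\<exists>(s :: nat \<Rightarrow> nat) lbar.
       strict_mono s \<and> (\<lambda>j. x (s j)) \<longlonglongrightarrow> xbar \<and>
       0 \<in> (\<lambda>h. h - (\<Sum>i\<in>E \<union> I. lbar i *\<^sub>R nabla (c i) xbar)) ` clarke_subdiff f xbar \<and>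
       (\<forall>i\<in>E. c i xbar = 0) \<and>
       (\<forall>i\<in>I. c i xbar \<ge> 0 \<and> lbar i \<ge> 0 \<and> lbar i * c i xbar = 0)"
    using s xs kkt feasible by (intro exI[of _ s] exI[of _ lbar]) (simp add: feasible_set_def)
qed

end
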